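(* The job-optimal relaxed unsplit stable assignment $x_{\text{jopt}}$ is machine-pessimal, and the machine-optimal relaxed unsplit stable assignment $x_{\text{mopt}}$ is job-pessimal. That is, for every relaxed unsplit stable assignment $x$, every machine weakly prefers $x$ to $x_{\text{jopt}}$, and every job weakly prefers $x$ to $x_{\text{mopt}}$.
   Context: An instance consists of a finite bipartite graph $G=(J\cup M,E)$ between jobs $J$ and machines $M$; each job $j$ has size $q(j)>0$, each machine $m$ capacity $q(m)>0$; each job strictly ranks its adjacent machines and each machine strictly ranks its adjacent jobs. $M$ contains a dummy machine $m_d$ adjacent to every job, ranked last by every job, with $q(m_d)>\sum_{j\in J}q(j)$. An assignment is $x:E\to\mathbb{R}_{\ge0}$, $x(j)=\sum_m x(jm)$, $x(m)=\sum_j x(jm)$. It is unsplit if $x(jm)\in\{0,q(j)\}$ for all $jm$ and $x(j)\le q(j)$ for all $j$. An unsplit $x$ is a relaxed unsplit assignment if for every machine $m$ with at least one assigned job, $x(m)-q(j_m)<q(m)$, where $j_m$ is the assigned job $m$ likes least. A relaxed unsplit assignment $x$ is stable if for every edge $jm$ with $x(jm)=0$, either $j$ is assigned to a machine it prefers to $m$, or $\sum_{j':m\text{ prefers } j'\text{ to } j}x(j'm)\ge q(m)$. For unsplit $x_1,x_2$: job $j$ weakly prefers $x_1$ to $x_2$ if its machine in $x_1$ is equal to or preferred by $j$ to its machine in $x_2$; machine $m$ weakly prefers $x_1$ to $x_2$ if either no edge incident to $m$ is positive in exactly one of $x_1,x_2$, or the edge $m$ ranks best among those incident edges positive in exactly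 one of them is positive in $x_1$. A relaxed unsplit stable assignment is job-optimal (machine-optimal) if every job (machine) weakly prefers it to every relaxed unsplit stable assignment, and job-pessimal (machine-pessimal) if every job (machine) weakly prefers every relaxed unsplit stable assignment to it. A job-optimal and a machine-optimal relaxed unsplit stable assignment exist; they are denoted $x_{\text{jopt}}$ and $x_{\text{mopt}}$. *)

theory Defs
  imports Complex_Main
begin

text \<open>
  Jobs and machines live in two separate types, so the edge set is a set of pairs (job, machine).
  \<open>(m, m') \<in> jpref I j\<close> means that job \<open>j\<close> strictly prefers \<open>m\<close> to \<open>m'\<close>;
  \<open>(j, j') \<in> mpref I m\<close> means that machine \<open>m\<close> strictly prefers \<open>j\<close> to \<open>j'\<close>.
\<close>

record ('j, 'm) alloc =
  jobs :: "'j set"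
  machines :: "'m set"
  edges :: "('j \<times> 'm) set"
  jsize :: "'j \<Rightarrow> real"
  mcap :: "'m \<Rightarrow> real"
  jpref :: "'j \<Rightarrow> ('m \<times> 'm) set"
  mpref :: "'m \<Rightarrow> ('j \<times> 'j) set"
  dummy :: "'m"

definition jadj :: "('j, 'm) alloc \<Rightarrow> 'j \<Rightarrow> 'm set" where
  "jadj I j = {m. (j, m) \<in> edges I}"

definition madj :: "('j, 'm) alloc \<Rightarrow> 'm \<Rightarrow> 'j set" where
  "madj I m = {j. (j, m) \<in> edges I}"

locale alloc_instance =
  fixes I :: "('j, 'm) alloc"
  assumes finite_jobs: "finite (jobs I)"
    and finite_machines: "finite (machines I)"
    and edges_subset: "edges I \<subseteq> jobs I \<times> machines I"
    and jsize_pos: "j \<in> jobs I \<Longrightarrow> 0 < jsize I j"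
    and mcap_pos: "m \<in> machines I \<Longrightarrow> 0 < mcap I m"
    and jpref_subset: "j \<in> jobs I \<Longrightarrow> jpref I j \<subseteq> jadj I j \<times> jadj I j"
    and jpref_order: "j \<in> jobs I \<Longrightarrow> strict_linear_order_on (jadj I j) (jpref I j)"
    and mpref_subset: "m \<in> machines I \<Longrightarrow> mpref I m \<subseteq> madj I m \<times> madj I m"
    and mpref_order: "m \<in> machines I \<Longrightarrow> strict_linear_order_on (madj I m) (mpref I m)"
    and dummy_machine: "dummy I \<in> machines I"
    and dummy_adjacent: "j \<in> jobs I \<Longrightarrow> (j, dummy I) \<in> edges I"
    and dummy_last: "(j, m) \<in> edges I \<Longrightarrow> m \<noteq> dummy I \<Longrightarrow> (m, dummy I) \<in> jpref I j"
    and dummy_cap: "(\<Sum>j\<in>jobs I. jsize I j) < mcap I (dummy I)"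

text \<open>
  An assignment is a total function of which only the values on the edges are relevant:
  every notion below looks at \<open>x\<close> on \<open>edges I\<close> only.
\<close>

definition assignment :: "('j, 'm) alloc \<Rightarrow> ('j \<times> 'm \<Rightarrow> real) \<Rightarrow> bool" where
  "assignment I x \<longleftrightarrow> (\<forall>e\<in>edges I. 0 \<le> x e)"

definition job_load :: "('j, 'm) alloc \<Rightarrow> ('j \<times> 'm \<Rightarrow> real) \<Rightarrow> 'j \<Rightarrow> real" where
  "job_load I x j = (\<Sum>m\<in>jadj I j. x (j, m))"

definition machine_load :: "('j, 'm) alloc \<Rightarrow> ('j \<times> 'm \<Rightarrow> real) \<Rightarrow> 'm \<Rightarrow> real" where
  "machine_load I x m = (\<Sum>j\<in>madj I m. x (j, m))"

definition unsplit :: "('j, 'm) alloc \<Rightarrow> ('j \<times> 'm \<Rightarrow> real) \<Rightarrow> bool" where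
  "unsplit I x \<longleftrightarrow> assignment I x
     \<and> (\<forall>(j, m)\<in>edges I. x (j, m) \<in> {0, jsize I j})
     \<and> (\<forall>j\<in>jobs I. job_load I x j \<le> jsize I j)"

definition assigned :: "('j, 'm) alloc \<Rightarrow> ('j \<times> 'm \<Rightarrow> real) \<Rightarrow> 'j \<Rightarrow> 'm \<Rightarrow> bool" where
  "assigned I x j m \<longleftrightarrow> (j, m) \<in> edges I \<and> 0 < x (j, m)"

definition least_job :: "('j, 'm) alloc \<Rightarrow> ('j \<times> 'm \<Rightarrow> real) \<Rightarrow> 'm \<Rightarrow> 'j" where
  "least_job I x m =
     (THE j. assigned I x j m \<and> (\<forall>j'. assigned I x j' m \<longrightarrow> j' \<noteq> j \<longrightarrow> (j', j) \<in> mpref I m))"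

definition relaxed_unsplit :: "('j, 'm) alloc \<Rightarrow> ('j \<times> 'm \<Rightarrow> real) \<Rightarrow> bool" where
  "relaxed_unsplit I x \<longleftrightarrow> unsplit I x
     \<and> (\<forall>m\<in>machines I. (\<exists>j. assigned I x j m) \<longrightarrow>
          machine_load I x m - jsize I (least_job I x m) < mcap I m)"

definition relaxed_unsplit_stable :: "('j, 'm) alloc \<Rightarrow> ('j \<times> 'm \<Rightarrow> real) \<Rightarrow> bool" where
  "relaxed_unsplit_stable I x \<longleftrightarrow> relaxed_unsplit I x
     \<and> (\<forall>(j, m)\<in>edges I. x (j, m) = 0 \<longrightarrow>
          (\<exists>m'. assigned I x j m' \<and> (m', m) \<in> jpref I j)
          \<or> mcap I m \<le> (\<Sum>j' | j' \<in> madj I m \<and> (j', j) \<in> mpref I m. x (j', m)))"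

text \<open>
  In an unsplit assignment a job is assigned to at most one machine, and in a relaxed unsplit stable
  one to exactly one (shown below), so the existentials denote ``its machine in \<open>x\<^sub>1\<close>, \<open>x\<^sub>2\<close>''.
\<close>

definition job_weakly_prefers ::
  "('j, 'm) alloc \<Rightarrow> 'j \<Rightarrow> ('j \<times> 'm \<Rightarrow> real) \<Rightarrow> ('j \<times> 'm \<Rightarrow> real) \<Rightarrow> bool" where
  "job_weakly_prefers I j x\<^sub>1 x\<^sub>2 \<longleftrightarrow>
     (\<exists>m\<^sub>1 m\<^sub>2. assigned I x\<^sub>1 j m\<^sub>1 \<and> assigned I x\<^sub>2 j m\<^sub>2 \<and> (m\<^sub>1 = m\<^sub>2 \<or> (m\<^sub>1, m\<^sub>2) \<in> jpref I j))"

definition differing_jobs ::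
  "('j, 'm) alloc \<Rightarrow> 'm \<Rightarrow> ('j \<times> 'm \<Rightarrow> real) \<Rightarrow> ('j \<times> 'm \<Rightarrow> real) \<Rightarrow> 'j set" where
  "differing_jobs I m x\<^sub>1 x\<^sub>2 = {j \<in> madj I m. (0 < x\<^sub>1 (j, m)) \<noteq> (0 < x\<^sub>2 (j, m))}"

definition machine_weakly_prefers ::
  "('j, 'm) alloc \<Rightarrow> 'm \<Rightarrow> ('j \<times> 'm \<Rightarrow> real) \<Rightarrow> ('j \<times> 'm \<Rightarrow> real) \<Rightarrow> bool" where
  "machine_weakly_prefers I m x\<^sub>1 x\<^sub>2 \<longleftrightarrow>
     differing_jobs I m x\<^sub>1 x\<^sub>2 = {}
     \<or> (\<exists>j\<in>differing_jobs I m x\<^sub>1 x\<^sub>2.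
          (\<forall>j'\<in>differing_jobs I m x\<^sub>1 x\<^sub>2. j' \<noteq> j \<longrightarrow> (j, j') \<in> mpref I m) \<and> 0 < x\<^sub>1 (j, m))"

definition job_optimal :: "('j, 'm) alloc \<Rightarrow> ('j \<times> 'm \<Rightarrow> real) \<Rightarrow> bool" where
  "job_optimal I x \<longleftrightarrow> relaxed_unsplit_stable I x
     \<and> (\<forall>y. relaxed_unsplit_stable I y \<longrightarrow> (\<forall>j\<in>jobs I. job_weakly_prefers I j x y))"

definition machine_optimal :: "('j, 'm) alloc \<Rightarrow> ('j \<times> 'm \<Rightarrow> real) \<Rightarrow> bool" where
  "machine_optimal I x \<longleftrightarrow> relaxed_unsplit_stable I x
     \<and> (\<forall>y. relaxed_unsplit_stable I y \<longrightarrow> (\<forall>m\<in>machines I. machine_weakly_prefers I m x y))"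

definition job_pessimal :: "('j, 'm) alloc \<Rightarrow> ('j \<times> 'm \<Rightarrow> real) \<Rightarrow> bool" where
  "job_pessimal I x \<longleftrightarrow> relaxed_unsplit_stable I x
     \<and> (\<forall>y. relaxed_unsplit_stable I y \<longrightarrow> (\<forall>j\<in>jobs I. job_weakly_prefers I j y x))"

definition machine_pessimal :: "('j, 'm) alloc \<Rightarrow> ('j \<times> 'm \<Rightarrow> real) \<Rightarrow> bool" where
  "machine_pessimal I x \<longleftrightarrow> relaxed_unsplit_stable I x
     \<and> (\<forall>y. relaxed_unsplit_stable I y \<longrightarrow> (\<forall>m\<in>machines I. machine_weakly_prefers I m y x))"

context alloc_instance
begin

lemma finite_jadj: "finite (jadj I j)"
  by (rule finite_subset[OF _ finite_machines]) (use edges_subset in \<open>auto simp: jadj_def\<close>)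

lemma unsplit_assigned_unique:
  assumes x: "unsplit I x" and m: "assigned I x j m" and m': "assigned I x j m'"
  shows "m = m'"
proof (rule ccontr)
  assume neq: "m \<noteq> m'"
  have j: "j \<in> jobs I" using m edges_subset by (auto simp: assigned_def)
  have eq: "x (j, m) = jsize I j" "x (j, m') = jsize I j"
    using x m m' by (auto simp: unsplit_def assigned_def)
  have "x (j, m) + x (j, m') = (\<Sum>k\<in>{m, m'}. x (j, k))" using neq by simp
  also have "\<dots> \<le> job_load I x j"
    unfolding job_load_def
    by (rule sum_mono2[OF finite_jadj])
      (use x m m' in \<open>auto simp: unsplit_def assignment_def assigned_def jadj_def\<close>)
  also have "\<dots> \<le> jsize I j" using x j by (auto simp: unsplit_def)
  finally show False using eq jsize_pos[OF j] by simp
qed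

lemma stable_assigned_ex1:
  assumes x: "relaxed_unsplit_stable I x" and j: "j \<in> jobs I"
  shows "\<exists>!m. assigned I x j m"
proof -
  have u: "unsplit I x" using x by (simp add: relaxed_unsplit_stable_def relaxed_unsplit_def)
  have "\<exists>m. assigned I x j m"
  proof (rule ccontr)
    assume no: "\<nexists>m. assigned I x j m"
    let ?d = "dummy I"
    let ?S = "{j'. j' \<in> madj I ?d \<and> (j', j) \<in> mpref I ?d}"
    have e: "(j, ?d) \<in> edges I" by (rule dummy_adjacent[OF j])
    then have "x (j, ?d) = 0"
      using no u by (force simp: assigned_def unsplit_def assignment_def)
    then have "mcap I ?d \<le> (\<Sum>j'\<in>?S. x (j', ?d))"
      using x e no by (fastforce simp: relaxed_unsplit_stable_def)
    also have "\<dots> \<le> (\<Sum>j'\<in>?S. jsize I j')"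
    proof (rule sum_mono)
      fix j' assume "j' \<in> ?S"
      then have e': "(j', ?d) \<in> edges I" by (simp add: madj_def)
      then have "j' \<in> jobs I" using edges_subset by auto
      then show "x (j', ?d) \<le> jsize I j'"
        using u e' jsize_pos[of j'] by (auto simp: unsplit_def)
    qed
    also have "\<dots> \<le> (\<Sum>j'\<in>jobs I. jsize I j')"
      by (rule sum_mono2[OF finite_jobs])
        (use edges_subset jsize_pos in \<open>auto simp: madj_def less_imp_le\<close>)
    finally show False using dummy_cap by simp
  qed
  then show ?thesis using unsplit_assigned_unique[OF u] by blast
qed

end

end

theory Submission
  imports Defs
begin

text \<open>
  A machine accepts a job iff the jobs it likes better among its candidates do not yet fill it, and a
  relaxed unsplit stable assignment is a map from jobs to machines in which every machine accepts its
  own jobs and rejects every job that would rather come to it. If all jobs weakly prefer \<open>x\<close> to \<open>y\<close>,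
  then the best job of \<open>m\<close> on which \<open>x\<close> and \<open>y\<close> differ belongs to \<open>y\<close>: otherwise \<open>y\<close> already fills \<open>m\<close>
  with better jobs, and so does \<open>x\<close>. This gives the first half.

  For the second half, send every job to the worse of its two machines in \<open>x\<close> and \<open>y\<close>. Machines
  still reject the jobs that would rather come to them, and letting overfull machines reject further
  jobs (deferred acceptance) ends in a stable \<open>z\<close> to which all jobs weakly prefer both \<open>x\<close> and \<open>y\<close>.
  By the first argument machines weakly prefer \<open>z\<close> to \<open>x\<close>. If \<open>x\<close> is machine-optimal, antisymmetry of the
  lexicographic machine preference forces \<open>z = x\<close>, so all jobs weakly prefer \<open>y\<close> to \<open>x\<close>.
\<close>

section \<open>Extremal elements of finite strict linear orders\<close>

lemma strict_linear_order_on_ex_first: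
  assumes r: "strict_linear_order_on B r" and "finite A" "A \<noteq> {}" "A \<subseteq> B"
  shows "\<exists>a\<in>A. \<forall>b\<in>A. b \<noteq> a \<longrightarrow> (a, b) \<in> r"
  using assms(2-4)
proof (induction A rule: finite_ne_induct)
  case (singleton a)
  then show ?case by simp
next
  case (insert c A)
  then obtain a where a: "a \<in> A" "\<forall>b\<in>A. b \<noteq> a \<longrightarrow> (a, b) \<in> r" by auto
  have "c \<in> B" "a \<in> B" "c \<noteq> a" using insert a(1) by auto
  then consider "(a, c) \<in> r" | "(c, a) \<in> r"
    using r by (auto simp: strict_linear_order_on_def total_on_def)
  then show ?case
  proof cases
    case 1
    then show ?thesis using a by auto
  next
    case 2
    have "\<forall>b\<in>A. (c, b) \<in> r"
      using a 2 r unfolding strict_linear_order_on_def by (metis transD)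
    then show ?thesis by auto
  qed
qed

text \<open>Turns the existence of a first element into that of a last one, as needed for the least
  liked job on a machine.\<close>

lemma strict_linear_order_on_converse:
  "strict_linear_order_on B r \<Longrightarrow> strict_linear_order_on B (r\<inverse>)"
  by (simp add: strict_linear_order_on_def)

context alloc_instance
begin

section \<open>Assignments as maps from jobs to machines\<close>

definition valid :: "('j \<Rightarrow> 'm) \<Rightarrow> bool" where
  "valid p \<longleftrightarrow> (\<forall>j\<in>jobs I. (j, p j) \<in> edges I)"

definition represents :: "('j \<times> 'm \<Rightarrow> real) \<Rightarrow> ('j \<Rightarrow> 'm) \<Rightarrow> bool" where
  "represents x p \<longleftrightarrow> valid p \<and>
     (\<forall>j m. (j, m) \<in> edges I \<longrightarrow> x (j, m) = (if p j = m then jsize I j else 0))"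

text \<open>The job \<open>j\<close> need not be on \<open>m\<close>: one quantity decides both
  whether \<open>m\<close> keeps a job it holds and whether it turns down one that would come. The
  size of \<open>j\<close> itself is left out, which reflects the relaxed capacity.\<close>

definition load_before :: "('j \<Rightarrow> 'm) \<Rightarrow> 'm \<Rightarrow> 'j \<Rightarrow> real" where
  "load_before p m j = (\<Sum>j' | j' \<in> jobs I \<and> p j' = m \<and> (j', j) \<in> mpref I m. jsize I j')"

definition accepting :: "('j \<Rightarrow> 'm) \<Rightarrow> bool" where
  "accepting p \<longleftrightarrow> (\<forall>j\<in>jobs I. load_before p (p j) j < mcap I (p j))"

definition rejecting :: "('j \<Rightarrow> 'm) \<Rightarrow> bool" where
  "rejecting p \<longleftrightarrow>
     (\<forall>j m. (j, m) \<in> edges I \<longrightarrow> (m, p j) \<in> jpref I j \<longrightarrow> mcap I m \<le> load_before p m j)"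

definition jobs_prefer :: "('j \<Rightarrow> 'm) \<Rightarrow> ('j \<Rightarrow> 'm) \<Rightarrow> bool" where
  "jobs_prefer p q \<longleftrightarrow> (\<forall>j\<in>jobs I. p j = q j \<or> (p j, q j) \<in> jpref I j)"

section \<open>Basic facts on edges, preferences and loads\<close>

lemma edgeD: "(j, m) \<in> edges I \<Longrightarrow> j \<in> jobs I \<and> m \<in> machines I"
  using edges_subset by auto

lemma finite_madj: "finite (madj I m)"
  by (rule finite_subset[OF _ finite_jobs]) (use edges_subset in \<open>auto simp: madj_def\<close>)

lemma jpref_trans: "j \<in> jobs I \<Longrightarrow> (a, b) \<in> jpref I j \<Longrightarrow> (b, c) \<in> jpref I j \<Longrightarrow> (a, c) \<in> jpref I j"
  using jpref_order[of j] by (auto simp: strict_linear_order_on_def dest: transD)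

lemma jpref_irrefl: "j \<in> jobs I \<Longrightarrow> (a, a) \<notin> jpref I j"
  using jpref_order[of j] by (auto simp: strict_linear_order_on_def irrefl_def)

lemma jpref_total:
  "(j, a) \<in> edges I \<Longrightarrow> (j, b) \<in> edges I \<Longrightarrow> a \<noteq> b \<Longrightarrow> (a, b) \<in> jpref I j \<or> (b, a) \<in> jpref I j"
  using jpref_order[of j] edgeD[of j a]
  by (auto simp: strict_linear_order_on_def total_on_def jadj_def)

lemma mpref_trans:
  "m \<in> machines I \<Longrightarrow> (a, b) \<in> mpref I m \<Longrightarrow> (b, c) \<in> mpref I m \<Longrightarrow> (a, c) \<in> mpref I m"
  using mpref_order[of m] by (auto simp: strict_linear_order_on_def dest: transD)

lemma mpref_irrefl: "m \<in> machines I \<Longrightarrow> (a, a) \<notin> mpref I m"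
  using mpref_order[of m] by (auto simp: strict_linear_order_on_def irrefl_def)

lemma mpref_edges: "m \<in> machines I \<Longrightarrow> (a, b) \<in> mpref I m \<Longrightarrow> (a, m) \<in> edges I \<and> (b, m) \<in> edges I"
  using mpref_subset[of m] by (auto simp: madj_def)

lemma validD: "valid p \<Longrightarrow> j \<in> jobs I \<Longrightarrow> (j, p j) \<in> edges I"
  by (simp add: valid_def)

lemma sum_jsize_mono:
  "A \<subseteq> B \<Longrightarrow> B \<subseteq> jobs I \<Longrightarrow> (\<Sum>j\<in>A. jsize I j) \<le> (\<Sum>j\<in>B. jsize I j)"
  by (rule sum_mono2) (auto intro: finite_subset[OF _ finite_jobs] less_imp_le[OF jsize_pos])

lemma load_before_mono:
  assumes "\<And>j'. j' \<in> jobs I \<Longrightarrow> p j' = m \<Longrightarrow> (j', j) \<in> mpref I m \<Longrightarrow> q j' = m \<and> (j', k) \<in> mpref I m"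
  shows "load_before p m j \<le> load_before q m k"
  unfolding load_before_def by (rule sum_jsize_mono) (use assms in auto)

section \<open>Translation between stable assignments and maps\<close>

lemma represents_assigned:
  assumes "represents x p"
  shows "assigned I x j m \<longleftrightarrow> j \<in> jobs I \<and> p j = m"
proof -
  have "x (j, m) = (if p j = m then jsize I j else 0)" if "(j, m) \<in> edges I"
    using assms that by (simp add: represents_def)
  moreover have "(j, p j) \<in> edges I" if "j \<in> jobs I"
    using assms that by (simp add: represents_def valid_def)
  ultimately show ?thesis
    using edgeD[of j m] jsize_pos[of j] by (auto simp: assigned_def split: if_splits)
qed

lemma represents_sum_better:
  assumes "represents x p" "m \<in> machines I"
  shows "(\<Sum>j' | j' \<in> madj I m \<and> (j', j) \<in> mpref I m. x (j', m)) = load_before p m j"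
proof -
  let ?S = "{j'. j' \<in> madj I m \<and> (j', j) \<in> mpref I m}"
  have "(\<Sum>j'\<in>?S. x (j', m)) = (\<Sum>j'\<in>?S. if p j' = m then jsize I j' else 0)"
    using assms by (intro sum.cong) (auto simp: represents_def madj_def)
  also have "\<dots> = (\<Sum>j'\<in>{j' \<in> ?S. p j' = m}. jsize I j')"
    by (rule sum.inter_filter[symmetric]) (simp add: finite_madj)
  also have "{j' \<in> ?S. p j' = m} = {j'. j' \<in> jobs I \<and> p j' = m \<and> (j', j) \<in> mpref I m}"
    using edgeD mpref_edges[OF assms(2)] by (auto simp: madj_def)
  finally show ?thesis by (simp add: load_before_def)
qed

text \<open>Every job on \<open>m\<close> other than the last one precedes it, so taking
  \<open>l\<close> out of the load of \<open>m\<close> leaves exactly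
  \<open>load_before p m l\<close>. The relaxed capacity condition thus becomes acceptance of
  \<open>l\<close>.\<close>

lemma least_job:
  assumes x: "represents x p" and m: "\<exists>j. assigned I x j m"
  defines "l \<equiv> least_job I x m"
  shows "l \<in> jobs I" "p l = m"
    "\<And>j. j \<in> jobs I \<Longrightarrow> p j = m \<Longrightarrow> j \<noteq> l \<Longrightarrow> (j, l) \<in> mpref I m"
    "machine_load I x m = load_before p m l + jsize I l"
proof -
  let ?A = "{j. assigned I x j m}"
  have e: "j \<in> madj I m" if "j \<in> ?A" for j using that by (auto simp: assigned_def madj_def)
  have mm: "m \<in> machines I" using m edgeD by (auto simp: assigned_def)
  have "\<exists>a\<in>?A. \<forall>b\<in>?A. b \<noteq> a \<longrightarrow> (a, b) \<in> (mpref I m)\<inverse>"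
    by (rule strict_linear_order_on_ex_first[OF strict_linear_order_on_converse[OF mpref_order[OF mm]]])
      (use m e in \<open>auto intro: finite_subset[OF _ finite_madj[of m]]\<close>)
  then obtain a where a: "assigned I x a m"
    "\<And>b. assigned I x b m \<Longrightarrow> b \<noteq> a \<Longrightarrow> (b, a) \<in> mpref I m" by auto
  have "l = a" unfolding l_def least_job_def
    by (rule the_equality) (use a mpref_trans[OF mm] mpref_irrefl[OF mm] in blast)+
  with a show lj: "l \<in> jobs I" and lm: "p l = m"
    and better: "\<And>j. j \<in> jobs I \<Longrightarrow> p j = m \<Longrightarrow> j \<noteq> l \<Longrightarrow> (j, l) \<in> mpref I m"
    by (auto simp: represents_assigned[OF x])
  have le: "(l, m) \<in> edges I" using x lj lm by (auto simp: represents_def valid_def)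
  have "machine_load I x m = (\<Sum>j\<in>madj I m - {l}. x (j, m)) + x (l, m)"
    unfolding machine_load_def using le finite_madj[of m]
    by (subst sum.remove[of _ l]) (auto simp: madj_def)
  also have "(\<Sum>j\<in>madj I m - {l}. x (j, m))
      = (\<Sum>j' | j' \<in> madj I m \<and> (j', l) \<in> mpref I m. x (j', m))"
  proof (rule sum.mono_neutral_right)
    show "\<forall>i\<in>madj I m - {l} - {j' \<in> madj I m. (j', l) \<in> mpref I m}. x (i, m) = 0"
      using x better edgeD by (auto simp: represents_def madj_def)
  qed (use finite_madj mpref_irrefl[OF mm] in auto)
  finally show "machine_load I x m = load_before p m l + jsize I l"
    using x le lm by (simp add: represents_sum_better[OF x mm]) (simp add: represents_def)
qed

lemma stable_represents:
  assumes x: "relaxed_unsplit_stable I x"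
  obtains p where "represents x p" "accepting p" "rejecting p"
proof -
  define p where "p j = (THE m. assigned I x j m)" for j
  have u: "unsplit I x" using x by (simp add: relaxed_unsplit_stable_def relaxed_unsplit_def)
  have p: "assigned I x j m \<longleftrightarrow> p j = m" if "j \<in> jobs I" for j m
    using stable_assigned_ex1[OF x that] theI'[OF stable_assigned_ex1[OF x that]]
    unfolding p_def by blast
  have r: "represents x p"
    unfolding represents_def valid_def
  proof (intro conjI ballI allI impI)
    fix j assume "j \<in> jobs I"
    then show "(j, p j) \<in> edges I" using p[of j "p j"] by (simp add: assigned_def)
  next
    fix j m assume e: "(j, m) \<in> edges I"
    then show "x (j, m) = (if p j = m then jsize I j else 0)"
      using u p[of j m] edgeD[OF e] jsize_pos[of j] by (auto simp: unsplit_def assigned_def)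
  qed
  have "accepting p"
    unfolding accepting_def
  proof
    fix j assume j: "j \<in> jobs I"
    let ?m = "p j" and ?l = "least_job I x (p j)"
    have mm: "?m \<in> machines I" using r j edgeD by (auto simp: represents_def valid_def)
    have a: "\<exists>j. assigned I x j ?m" using p j by blast
    note l = least_job[OF r a]
    \<comment> \<open>Either \<open>j\<close> is the last job on its machine or it precedes the last
      job, so the last job has the largest load before it.\<close>
    have "load_before p ?m j \<le> load_before p ?m ?l"
      by (rule load_before_mono) (metis j l(3) mm mpref_trans)
    also have "\<dots> < mcap I ?m"
      using x a mm l(4) by (auto simp: relaxed_unsplit_stable_def relaxed_unsplit_def)
    finally show "load_before p ?m j < mcap I ?m" .
  qed
  moreover have "rejecting p"
    unfolding rejecting_def
  proof (intro allI impI)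
    fix j m assume e: "(j, m) \<in> edges I" and pr: "(m, p j) \<in> jpref I j"
    have j: "j \<in> jobs I" and m: "m \<in> machines I" using edgeD[OF e] by auto
    have "m \<noteq> p j" using jpref_irrefl[OF j] pr by auto
    then have "x (j, m) = 0" using r e by (auto simp: represents_def)
    moreover have "\<not> (\<exists>m'. assigned I x j m' \<and> (m', m) \<in> jpref I j)"
      using p[OF j] pr jpref_trans[OF j] jpref_irrefl[OF j] by metis
    ultimately show "mcap I m \<le> load_before p m j"
      using x e represents_sum_better[OF r m] unfolding relaxed_unsplit_stable_def by fastforce
  qed
  ultimately show ?thesis using that r by blast
qed

text \<open>The capacity condition is acceptance of the least liked job. For an edge carrying no
  load, totality of the order of \<open>j\<close> leaves two cases: \<open>p j\<close> is better for
  \<open>j\<close>, or \<open>m\<close> is better and \<open>rejecting p\<close> fills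
  \<open>m\<close>.\<close>

lemma represents_stable:
  assumes r: "represents x p" and a: "accepting p" and rej: "rejecting p"
  shows "relaxed_unsplit_stable I x"
proof -
  have v: "valid p" using r by (simp add: represents_def)
  have "job_load I x j = jsize I j" if "j \<in> jobs I" for j
  proof -
    have "job_load I x j = (\<Sum>m\<in>jadj I j. if p j = m then jsize I j else 0)"
      unfolding job_load_def using r by (intro sum.cong) (auto simp: represents_def jadj_def)
    moreover have "p j \<in> jadj I j" using validD[OF v that] by (simp add: jadj_def)
    ultimately show ?thesis by (simp add: finite_jadj)
  qed
  then have "unsplit I x"
    using r jsize_pos edgeD
    by (fastforce simp: unsplit_def assignment_def represents_def intro: less_imp_le)
  moreover have "machine_load I x m - jsize I (least_job I x m) < mcap I m"
    if "\<exists>j. assigned I x j m" for m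
    using least_job[OF r that] a unfolding accepting_def by auto
  moreover have "(\<exists>m'. assigned I x j m' \<and> (m', m) \<in> jpref I j)
      \<or> mcap I m \<le> (\<Sum>j' | j' \<in> madj I m \<and> (j', j) \<in> mpref I m. x (j', m))"
    if e: "(j, m) \<in> edges I" and 0: "x (j, m) = 0" for j m
  proof -
    have j: "j \<in> jobs I" and m: "m \<in> machines I" using edgeD[OF e] by auto
    have "p j \<noteq> m" using r e 0 jsize_pos[OF j] by (auto simp: represents_def)
    then consider "(p j, m) \<in> jpref I j" | "(m, p j) \<in> jpref I j"
      using jpref_total[OF e validD[OF v j]] by auto
    then show ?thesis
    proof cases
      case 1
      then show ?thesis using represents_assigned[OF r] j by auto
    next
      case 2
      then show ?thesis
        using rej e represents_sum_better[OF r m] by (auto simp: rejecting_def)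
    qed
  qed
  ultimately show ?thesis
    unfolding relaxed_unsplit_stable_def relaxed_unsplit_def by blast
qed

section \<open>Comparing two stable assignments\<close>

lemma represents_job_weakly_prefers:
  assumes "represents x p" "represents y q" "j \<in> jobs I"
  shows "job_weakly_prefers I j x y \<longleftrightarrow> p j = q j \<or> (p j, q j) \<in> jpref I j"
  using assms(3) by (auto simp: job_weakly_prefers_def represents_assigned[OF assms(1)]
      represents_assigned[OF assms(2)])

lemma represents_differing_jobs:
  assumes "represents x p" "represents y q"
  shows "differing_jobs I m x y = {j \<in> jobs I. (p j = m) \<noteq> (q j = m)}"
  using represents_assigned[OF assms(1), of _ m] represents_assigned[OF assms(2), of _ m] edgeD
  unfolding differing_jobs_def madj_def assigned_def by blast

lemma jobs_prefer_imp_machine_weakly_prefers: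
  assumes x: "represents x p" and y: "represents y q"
    and a: "accepting p" and rej: "rejecting q" and pq: "jobs_prefer p q" and m: "m \<in> machines I"
  shows "machine_weakly_prefers I m y x"
proof (cases "differing_jobs I m y x = {}")
  case True
  then show ?thesis by (simp add: machine_weakly_prefers_def)
next
  case False
  let ?D = "differing_jobs I m y x"
  have D: "?D \<subseteq> madj I m" by (auto simp: differing_jobs_def)
  obtain j where j: "j \<in> ?D" and best: "\<forall>k\<in>?D. k \<noteq> j \<longrightarrow> (j, k) \<in> mpref I m"
    using strict_linear_order_on_ex_first[OF mpref_order[OF m] finite_subset[OF D finite_madj] False D]
    by blast
  have e: "(j, m) \<in> edges I" using D j by (auto simp: madj_def)
  have jj: "j \<in> jobs I" using edgeD[OF e] by simp
  have "q j = m"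
  proof (rule ccontr)
    assume "q j \<noteq> m"
    then have "p j = m" using j represents_differing_jobs[OF y x] by auto
    then have "(m, q j) \<in> jpref I j" using pq jj \<open>q j \<noteq> m\<close> by (auto simp: jobs_prefer_def)
    then have "mcap I m \<le> load_before q m j" using rej e by (auto simp: rejecting_def)
    also have "\<dots> \<le> load_before p m j"
    proof (rule load_before_mono)
      fix k assume k: "k \<in> jobs I" "q k = m" "(k, j) \<in> mpref I m"
      \<comment> \<open>Since \<open>j\<close> comes first in \<open>?D\<close>, the jobs better
        than \<open>j\<close> are on \<open>m\<close> either in both assignments or in
        neither.\<close>
      then have "k \<notin> ?D" using best mpref_trans[OF m] mpref_irrefl[OF m] by metis
      then show "p k = m \<and> (k, j) \<in> mpref I m"
        using k represents_differing_jobs[OF y x] by auto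
    qed
    also have "\<dots> < mcap I m" using a jj \<open>p j = m\<close> by (auto simp: accepting_def)
    finally show False by simp
  qed
  then have "0 < y (j, m)" using represents_assigned[OF y, of j m] jj by (simp add: assigned_def)
  then show ?thesis using j best by (auto simp: machine_weakly_prefers_def)
qed

text \<open>The best differing job is unique, so it would have to be positive in both assignments,
  and then it would not differ.\<close>

lemma machine_weakly_prefers_antisym:
  assumes m: "m \<in> machines I"
    and "machine_weakly_prefers I m x y" "machine_weakly_prefers I m y x"
  shows "differing_jobs I m x y = {}"
proof (rule ccontr)
  assume ne: "differing_jobs I m x y \<noteq> {}"
  have D: "differing_jobs I m y x = differing_jobs I m x y" by (auto simp: differing_jobs_def)
  obtain j where j: "j \<in> differing_jobs I m x y" "0 < x (j, m)"
    "\<forall>k\<in>differing_jobs I m x y. k \<noteq> j \<longrightarrow> (j, k) \<in> mpref I m"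
    using assms(2) ne by (auto simp: machine_weakly_prefers_def)
  obtain k where k: "k \<in> differing_jobs I m x y" "0 < y (k, m)"
    "\<forall>j\<in>differing_jobs I m x y. j \<noteq> k \<longrightarrow> (k, j) \<in> mpref I m"
    using assms(3) ne D by (auto simp: machine_weakly_prefers_def)
  have "j = k" using j k mpref_trans[OF m] mpref_irrefl[OF m] by metis
  then show False using j k by (auto simp: differing_jobs_def)
qed

section \<open>The worse of two machines for every job\<close>

definition worse :: "('j \<Rightarrow> 'm) \<Rightarrow> ('j \<Rightarrow> 'm) \<Rightarrow> 'j \<Rightarrow> 'm" where
  "worse p q j = (if (p j, q j) \<in> jpref I j then q j else p j)"

lemma jobs_prefer_worse:
  assumes "valid p" "valid q"
  shows "jobs_prefer p (worse p q)" "jobs_prefer q (worse p q)"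
  using jpref_total[OF validD[OF assms(1)] validD[OF assms(2)]]
  unfolding jobs_prefer_def worse_def by fastforce+

lemma valid_worse: "valid p \<Longrightarrow> valid q \<Longrightarrow> valid (worse p q)"
  by (auto simp: valid_def worse_def)

text \<open>
  The first job \<open>k\<close> in the order of \<open>m\<close> that would rather come to \<open>m\<close> is rejected under \<open>p\<close> or \<open>q\<close>
  already, and by minimality of \<open>k\<close> the jobs causing this rejection stay on \<open>m\<close>.
\<close>

lemma rejecting_worse:
  assumes p: "valid p" and q: "valid q" and rp: "rejecting p" and rq: "rejecting q"
  shows "rejecting (worse p q)"
  unfolding rejecting_def
proof (intro allI impI)
  fix j m assume e: "(j, m) \<in> edges I" and pr: "(m, worse p q j) \<in> jpref I j"
  have m: "m \<in> machines I" using edgeD[OF e] by simp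
  let ?K = "{k \<in> madj I m. (m, worse p q k) \<in> jpref I k \<and> (k = j \<or> (k, j) \<in> mpref I m)}"
  have K: "finite ?K" "?K \<noteq> {}" "?K \<subseteq> madj I m" using finite_madj e pr by (auto simp: madj_def)
  obtain k where k: "k \<in> ?K" and first: "\<forall>i\<in>?K. i \<noteq> k \<longrightarrow> (k, i) \<in> mpref I m"
    using strict_linear_order_on_ex_first[OF mpref_order[OF m] K] by (elim bexE)
  have ek: "(k, m) \<in> edges I" using k by (simp add: madj_def)
  have stay: "load_before s m k \<le> load_before (worse p q) m j" if "jobs_prefer s (worse p q)" for s
  proof (rule load_before_mono)
    fix i assume i: "i \<in> jobs I" "s i = m" "(i, k) \<in> mpref I m"
    then have ij: "(i, j) \<in> mpref I m" using k mpref_trans[OF m] by blast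
    have "i \<notin> ?K"
    proof
      assume "i \<in> ?K"
      moreover have "i \<noteq> k" using i(3) mpref_irrefl[OF m] by auto
      ultimately have "(k, i) \<in> mpref I m" using first by blast
      then show False using mpref_trans[OF m _ i(3)] mpref_irrefl[OF m] by blast
    qed
    then have "(m, worse p q i) \<notin> jpref I i"
      using ij mpref_edges[OF m ij] by (simp add: madj_def)
    \<comment> \<open>Passing from \<open>s\<close> to \<open>worse p q\<close> could only move
      \<open>i\<close> from \<open>m\<close> to a machine it likes less, which has just been
      excluded.\<close>
    then show "worse p q i = m \<and> (i, j) \<in> mpref I m"
      using that i ij by (auto simp: jobs_prefer_def)
  qed
  consider "(m, p k) \<in> jpref I k" | "(m, q k) \<in> jpref I k"
    using k by (auto simp: worse_def split: if_splits)
  then have "mcap I m \<le> load_before p m k \<or> mcap I m \<le> load_before q m k"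
    using rp rq ek by cases (auto simp: rejecting_def)
  then show "mcap I m \<le> load_before (worse p q) m j"
    using stay[OF jobs_prefer_worse(1)[OF p q]] stay[OF jobs_prefer_worse(2)[OF p q]] by linarith
qed

section \<open>Deferred acceptance\<close>

lemma load_before_dummy_less: "load_before p (dummy I) j < mcap I (dummy I)"
proof -
  have "load_before p (dummy I) j \<le> (\<Sum>j\<in>jobs I. jsize I j)"
    unfolding load_before_def by (rule sum_jsize_mono) auto
  then show ?thesis using dummy_cap by simp
qed

text \<open>One rejection: \<open>j\<close> moves from the overfull \<open>p j\<close> to its next
  machine. Only \<open>p j\<close> loses a job, and only jobs ranked after \<open>j\<close> notice;
  for these the jobs before \<open>j\<close> already fill \<open>p j\<close>. The dummy machine is
  never overfull, so a next machine exists.\<close>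

lemma rejecting_step:
  assumes p: "valid p" and rp: "rejecting p" and j: "j \<in> jobs I"
    and full: "mcap I (p j) \<le> load_before p (p j) j"
  obtains n where "(p j, n) \<in> jpref I j" "valid (p(j := n))" "rejecting (p(j := n))"
proof -
  let ?m = "p j"
  have e: "(j, ?m) \<in> edges I" by (rule validD[OF p j])
  have mm: "?m \<in> machines I" using edgeD[OF e] by simp
  let ?W = "{n. (?m, n) \<in> jpref I j}"
  have W: "?W \<subseteq> jadj I j" using jpref_subset[OF j] by auto
  have "?m \<noteq> dummy I" using full load_before_dummy_less[of p j] by auto
  then have "?W \<noteq> {}" using dummy_last[OF e] by auto
  then obtain n where n: "(?m, n) \<in> jpref I j"
    and next_best: "\<And>k. (?m, k) \<in> jpref I j \<Longrightarrow> k \<noteq> n \<Longrightarrow> (n, k) \<in> jpref I j"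
    using strict_linear_order_on_ex_first[OF jpref_order[OF j] finite_subset[OF W finite_jadj] _ W]
    by blast
  have ne: "n \<noteq> ?m" using n jpref_irrefl[OF j] by auto
  have "rejecting (p(j := n))"
    unfolding rejecting_def
  proof (intro allI impI)
    fix i k assume ei: "(i, k) \<in> edges I" and pr: "(k, (p(j := n)) i) \<in> jpref I i"
    have full_i: "mcap I k \<le> load_before p k i"
    proof (cases "i = j \<and> k = ?m")
      case True
      then show ?thesis using full by simp
    next
      case False
      have "(k, p i) \<in> jpref I i"
      proof (cases "i = j")
        case True
        \<comment> \<open>No machine lies strictly between \<open>?m\<close> and \<open>n\<close>
          for \<open>j\<close>, so \<open>k\<close> is above \<open>?m\<close> and had rejected
          \<open>j\<close> before the move.\<close>
        then have kn: "(k, n) \<in> jpref I j" "k \<noteq> ?m" using pr False by auto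
        then have "(?m, k) \<notin> jpref I j"
          using next_best jpref_trans[OF j] jpref_irrefl[OF j] by blast
        then show ?thesis using jpref_total[OF _ e] kn ei True by auto
      next
        case False
        then show ?thesis using pr by simp
      qed
      then show ?thesis using rp ei by (auto simp: rejecting_def)
    qed
    show "mcap I k \<le> load_before (p(j := n)) k i"
    \<comment> \<open>This is the only case in which the departure of \<open>j\<close> removes load
      before \<open>i\<close>.\<close>
    proof (cases "k = ?m \<and> (j, i) \<in> mpref I ?m")
      case True
      have "load_before p ?m j \<le> load_before (p(j := n)) ?m i"
        by (rule load_before_mono)
          (use True mpref_trans[OF mm] mpref_irrefl[OF mm] in auto)
      then show ?thesis using full True by simp
    next
      case False
      have "load_before p k i \<le> load_before (p(j := n)) k i"
        by (rule load_before_mono) (use False in auto)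
      then show ?thesis using full_i by simp
    qed
  qed
  moreover have "valid (p(j := n))" using p W n by (auto simp: valid_def jadj_def)
  ultimately show ?thesis using that n by blast
qed

lemma jobs_prefer_trans: "jobs_prefer p q \<Longrightarrow> jobs_prefer q r \<Longrightarrow> jobs_prefer p r"
  unfolding jobs_prefer_def by (metis jpref_trans)

text \<open>Rejections are repeated until every machine accepts its jobs. Each one strictly lowers
  the number of machines ranked below the current one, summed over all jobs, so the process
  ends.\<close>

lemma ex_accepting_below:
  assumes "valid p" "rejecting p"
  shows "\<exists>r. valid r \<and> rejecting r \<and> accepting r \<and> jobs_prefer p r"
  using assms
proof (induction "\<Sum>j\<in>jobs I. card {n. (p j, n) \<in> jpref I j}" arbitrary: p rule: less_induct)
  case less
  show ?case
  proof (cases "accepting p")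
    case True
    then show ?thesis using less.prems by (auto simp: jobs_prefer_def)
  next
    case False
    then obtain j where j: "j \<in> jobs I" and full: "mcap I (p j) \<le> load_before p (p j) j"
      by (auto simp: accepting_def not_less)
    obtain n where n: "(p j, n) \<in> jpref I j" "valid (p(j := n))" "rejecting (p(j := n))"
      using rejecting_step[OF less.prems j full] by blast
    have fin: "finite {n. (k, n) \<in> jpref I j}" for k
      by (rule finite_subset[OF _ finite_jadj[of j]]) (use jpref_subset[OF j] in auto)
    have "{k. (n, k) \<in> jpref I j} \<subset> {k. (p j, k) \<in> jpref I j}"
      using n(1) jpref_trans[OF j n(1)] jpref_irrefl[OF j] by auto
    then have "card {k. (n, k) \<in> jpref I j} < card {k. (p j, k) \<in> jpref I j}"
      by (rule psubset_card_mono[OF fin])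
    then have "(\<Sum>i\<in>jobs I. card {k. ((p(j := n)) i, k) \<in> jpref I i})
        < (\<Sum>i\<in>jobs I. card {k. (p i, k) \<in> jpref I i})"
      by (intro sum_strict_mono_ex1[OF finite_jobs]) (use j in \<open>auto intro!: bexI[of _ j]\<close>)
    then obtain r where r: "valid r" "rejecting r" "accepting r" "jobs_prefer (p(j := n)) r"
      using less.hyps n(2,3) by blast
    have "jobs_prefer p (p(j := n))" using n(1) by (auto simp: jobs_prefer_def)
    then show ?thesis using r jobs_prefer_trans by blast
  qed
qed

section \<open>Opposition of job and machine optimality\<close>

lemma job_optimal_imp_machine_pessimal:
  assumes x: "job_optimal I x"
  shows "machine_pessimal I x"
  unfolding machine_pessimal_def
proof (intro conjI allI impI ballI)
  show st: "relaxed_unsplit_stable I x" using x by (simp add: job_optimal_def)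
  fix y m assume y: "relaxed_unsplit_stable I y" and m: "m \<in> machines I"
  obtain p where p: "represents x p" "accepting p" using stable_represents[OF st] by blast
  obtain q where q: "represents y q" "rejecting q" using stable_represents[OF y] by blast
  have "jobs_prefer p q"
    using x y represents_job_weakly_prefers[OF p(1) q(1)]
    by (auto simp: job_optimal_def jobs_prefer_def)
  then show "machine_weakly_prefers I m y x"
    using jobs_prefer_imp_machine_weakly_prefers p q m by blast
qed

lemma machine_optimal_imp_job_pessimal:
  assumes x: "machine_optimal I x"
  shows "job_pessimal I x"
  unfolding job_pessimal_def
proof (intro conjI allI impI ballI)
  show st: "relaxed_unsplit_stable I x" using x by (simp add: machine_optimal_def)
  fix y j assume y: "relaxed_unsplit_stable I y" and j: "j \<in> jobs I"
  obtain p where p: "represents x p" "accepting p" "rejecting p"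
    using stable_represents[OF st] by blast
  obtain q where q: "represents y q" "rejecting q" using stable_represents[OF y] by blast
  have v: "valid p" "valid q" using p q by (auto simp: represents_def)
  obtain r where r: "valid r" "rejecting r" "accepting r" "jobs_prefer (worse p q) r"
    using ex_accepting_below[OF valid_worse[OF v] rejecting_worse[OF v p(3) q(2)]] by blast
  have pr: "jobs_prefer p r" and qr: "jobs_prefer q r"
    using r(4) jobs_prefer_worse[OF v] jobs_prefer_trans by blast+
  define z where "z = (\<lambda>(j, m). if r j = m then jsize I j else 0)"
  have z: "represents z r" using r(1) by (simp add: represents_def z_def)
  have m: "p j \<in> machines I" using validD[OF v(1) j] edgeD by blast
  \<comment> \<open>Agreement of \<open>x\<close> and \<open>z\<close> at the single machine
    \<open>p j\<close> suffices, since it forces \<open>r\<close> to leave \<open>j\<close>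
    there.\<close>
  have "machine_weakly_prefers I (p j) x z"
    using x represents_stable[OF z r(3,2)] m by (auto simp: machine_optimal_def)
  then have "differing_jobs I (p j) x z = {}"
    using machine_weakly_prefers_antisym[OF m]
      jobs_prefer_imp_machine_weakly_prefers[OF p(1) z p(2) r(2) pr m] by blast
  then have "r j = p j" using represents_differing_jobs[OF p(1) z] j by auto
  then show "job_weakly_prefers I j y x"
    using qr j by (force simp: represents_job_weakly_prefers[OF q(1) p(1)] jobs_prefer_def)
qed

end

theorem theorem3:
  fixes I :: "('j, 'm) alloc"
  assumes "alloc_instance I"
  shows "(\<forall>x_jopt. job_optimal I x_jopt \<longrightarrow> machine_pessimal I x_jopt) \<and>
         (\<forall>x_mopt. machine_optimal I x_mopt \<longrightarrow> job_pessimal I x_mopt)"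
proof -
  interpret alloc_instance I by (rule assms)
  show ?thesis using job_optimal_imp_machine_pessimal machine_optimal_imp_job_pessimal by blast
qed

end
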